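(* Consider the heterogeneous agents $$\dot x_i=\sum_{j=1}^N\alpha_{ij}(t)(y_j-y_i),\qquad y_i=\mathrm{sat}_i(x_i),\qquad i\in\mathcal V=\{1,\dots,N\},$$ with pairwise distinct saturation levels $s_i>0$, where the time-varying undirected graph satisfies the standing assumptions, is integrally connected over $[0,\infty)$, and satisfies $\alpha_{ij}(t)\in\{0\}\cup[\alpha_{\min},\alpha_{\max}]$ with constants $0<\alpha_{\min}\le\alpha_{\max}$. Assume not all $x_i(t_0)$ are equal. Then the agents achieve consensus if and only if $$\frac1N\Big|\sum_{i=1}^N x_i(t_0)\Big|\le\min_{i\in\mathcal V}s_i.$$
   Context: $\mathrm{sat}_i(x)=\mathrm{sign}(x)\min\{|x|,s_i\}$. Standing assumptions: $\alpha_{ij}(t)=\alpha_{ji}(t)\ge0$, each $\alpha_{ij}$ continuous on $[0,\infty)$ except on a set of measure zero; Carathéodory solutions. Integral graph: $\bar\alpha_{ij}=1$ if $\int_0^\infty\alpha_{ij}(t)dt=\infty$, else $0$; integrally connected means the integral graph is connected. Consensus: there is $C$ with $\lim_{t\to\infty}x_i(t)=C$ for all $i$. *)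

theory Defs
  imports "HOL-Analysis.Analysis"
begin

text \<open>Saturation: sat_i(x) = sign(x) * min(|x|, s_i).\<close>
definition sat :: "real \<Rightarrow> real \<Rightarrow> real" where
  "sat si v = sgn v * min \<bar>v\<bar> si"

text \<open>Standing assumptions on the weights: symmetric, nonnegative, and each
  weight is continuous on [0,infinity) except on a Lebesgue null set.\<close>
definition standing_assumptions :: "('n \<Rightarrow> 'n \<Rightarrow> real \<Rightarrow> real) \<Rightarrow> bool" where
  "standing_assumptions \<alpha> \<longleftrightarrow>
     (\<forall>i j t. \<alpha> i j t = \<alpha> j i t) \<and>
     (\<forall>i j t. t \<ge> 0 \<longrightarrow> \<alpha> i j t \<ge> 0) \<and>
     (\<forall>i j. \<exists>Z. Z \<in> null_sets lborel \<and>
        (\<forall>t \<in> {0..} - Z. continuous (at t within {0..}) (\<alpha> i j)))"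

text \<open>Edge of the integral graph: the integral of alpha_ij over [0,infinity) is infinite.\<close>
definition integral_edge :: "('n \<Rightarrow> 'n \<Rightarrow> real \<Rightarrow> real) \<Rightarrow> 'n \<Rightarrow> 'n \<Rightarrow> bool" where
  "integral_edge \<alpha> i j \<longleftrightarrow>
     (\<integral>\<^sup>+ t. ennreal (\<alpha> i j t) * indicator {0..} t \<partial>lborel) = \<infinity>"

text \<open>Integrally connected: the (undirected) integral graph on all agents is connected.\<close>
definition integrally_connected :: "('n \<Rightarrow> 'n \<Rightarrow> real \<Rightarrow> real) \<Rightarrow> bool" where
  "integrally_connected \<alpha> \<longleftrightarrow>
     (\<forall>i j. (i, j) \<in> {(a, b). a \<noteq> b \<and> integral_edge \<alpha> a b}\<^sup>*)"

text \<open>Right-hand side of the saturated consensus dynamics for agent i.\<close>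
definition sat_rhs :: "('n::finite \<Rightarrow> 'n \<Rightarrow> real \<Rightarrow> real) \<Rightarrow> ('n \<Rightarrow> real)
     \<Rightarrow> (real \<Rightarrow> 'n \<Rightarrow> real) \<Rightarrow> 'n \<Rightarrow> real \<Rightarrow> real" where
  "sat_rhs \<alpha> s x i \<tau> = (\<Sum>j\<in>UNIV. \<alpha> i j \<tau> * (sat (s j) (x \<tau> j) - sat (s i) (x \<tau> i)))"

text \<open>Caratheodory solution on [t0, infinity): each x_i is the integral of an
  (absolutely, i.e. Lebesgue) integrable right-hand side on every [t0,t],
  i.e. x_i is absolutely continuous and satisfies the ODE almost everywhere.\<close>
definition caratheodory_solution :: "('n::finite \<Rightarrow> 'n \<Rightarrow> real \<Rightarrow> real) \<Rightarrow> ('n \<Rightarrow> real)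
     \<Rightarrow> real \<Rightarrow> (real \<Rightarrow> 'n \<Rightarrow> real) \<Rightarrow> bool" where
  "caratheodory_solution \<alpha> s t0 x \<longleftrightarrow>
     (\<forall>i t. t \<ge> t0 \<longrightarrow>
        sat_rhs \<alpha> s x i absolutely_integrable_on {t0..t} \<and>
        x t i = x t0 i + integral {t0..t} (sat_rhs \<alpha> s x i))"

definition consensus :: "(real \<Rightarrow> 'n \<Rightarrow> real) \<Rightarrow> bool" where
  "consensus x \<longleftrightarrow> (\<exists>C. \<forall>i. ((\<lambda>t. x t i) \<longlongrightarrow> C) at_top)"

end

theory Submission
  imports Defs
begin

text \<open>
  For a threshold \<open>c \<ge> 0\<close> the total excess of the states above \<open>c\<close>, taken over the agents
  with \<open>s i > c\<close>, is nonincreasing, because flow across the cut between \<open>{i. y i > c}\<close> and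
  its complement always leaves the upper side; applied to \<open>x\<close> and \<open>- x\<close> at \<open>c = 0\<close>, this also
  bounds the states. Convergence of these quantities for all \<open>c\<close> forces
  every continuous trajectory \<open>y i\<close> to converge. A difference between the limits at the ends of
  an integral edge would transport an infinite amount out of a set of agents with bounded
  states, so all outputs share one limit \<open>Y\<close>. Only the agent with the smallest level can have
  \<open>\<bar>Y\<bar> = s i\<close>, so the others satisfy \<open>x i \<rightarrow> Y\<close>, and the conserved total determines the
  limit of the remaining state.
\<close>

section \<open>Saturation as clamping, and limits of real functions at infinity\<close>

lemma sat_eq_clamp: "r > 0 \<Longrightarrow> sat r v = max (- r) (min v r)"
  by (auto simp: sat_def sgn_if min_def max_def)

lemma sat_uminus: "sat r (- v) = - sat r v"
  by (simp add: sat_def sgn_if)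

text \<open>Cutting the interval from \<open>u\<close> to \<open>t\<close> into n + 1 equal pieces
  reduces the accumulated quadratic error to \<open>K * (t - u)\<^sup>2 / (n + 1)\<close>, which
  tends to 0.\<close>

lemma antimono_if_quadratic_increments:
  fixes f :: "real \<Rightarrow> real"
  assumes incr: "\<And>u t. a \<le> u \<Longrightarrow> u \<le> t \<Longrightarrow> f t - f u \<le> K * (t - u)\<^sup>2"
    and "a \<le> u" "u \<le> t"
  shows "f t \<le> f u"
proof -
  have bound: "f t - f u \<le> K * (t - u)\<^sup>2 / real (Suc n)" for n
  proof -
    define d where "d = (t - u) / real (Suc n)"
    have d: "d \<ge> 0" using assms by (simp add: d_def)
    have steps: "f (u + real m * d) - f u \<le> real m * (K * d\<^sup>2)" for m
    proof (induction m)
      case (Suc m)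
      have "f (u + real (Suc m) * d) - f (u + real m * d)
          \<le> K * ((u + real (Suc m) * d) - (u + real m * d))\<^sup>2"
        by (rule incr) (use assms d in \<open>auto simp: distrib_right intro: add_increasing2\<close>)
      also have "\<dots> = K * d\<^sup>2" by (simp add: algebra_simps)
      finally show ?case using Suc by (simp add: algebra_simps)
    qed simp
    have nd: "real (Suc n) * d = t - u" by (simp add: d_def)
    have "real (Suc n) * (K * d\<^sup>2) = K * (t - u)\<^sup>2 / real (Suc n)"
      by (simp add: d_def power2_eq_square field_simps del: of_nat_Suc)
    with steps[of "Suc n"] nd show ?thesis by (simp del: of_nat_Suc)
  qed
  have "(\<lambda>n. K * (t - u)\<^sup>2 / real (Suc n)) \<longlonglongrightarrow> 0"
    using LIMSEQ_Suc[OF lim_const_over_n[of "K * (t - u)\<^sup>2"]] by simp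
  then have "f t - f u \<le> 0"
    by (rule LIMSEQ_le_const) (use bound in auto)
  then show ?thesis by simp
qed

lemma antimono_bounded_below_tendsto:
  fixes f :: "real \<Rightarrow> real"
  assumes anti: "\<And>u t. a \<le> u \<Longrightarrow> u \<le> t \<Longrightarrow> f t \<le> f u"
    and lb: "\<And>t. a \<le> t \<Longrightarrow> B \<le> f t"
  obtains L where "(f \<longlongrightarrow> L) at_top"
proof -
  have bdd: "bdd_below (f ` {a..})" using lb by (auto intro!: bdd_belowI[of _ B])
  have "(f \<longlongrightarrow> Inf (f ` {a..})) at_top"
  proof (rule order_tendstoI)
    fix b assume "b < Inf (f ` {a..})"
    then have "b < f t" if "t \<ge> a" for t
      using cInf_lower[OF _ bdd, of "f t"] that by auto
    then show "\<forall>\<^sub>F t in at_top. b < f t"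
      by (auto simp: eventually_at_top_linorder)
  next
    fix b assume "Inf (f ` {a..}) < b"
    then obtain u where "u \<ge> a" "f u < b"
      using cInf_less_iff[OF _ bdd, of b] by auto
    then have "f t < b" if "t \<ge> u" for t
      using anti[of u t] that by simp
    then show "\<forall>\<^sub>F t in at_top. f t < b"
      by (auto simp: eventually_at_top_linorder)
  qed
  then show thesis by (rule that)
qed

text \<open>Intermediate value theorem: a tail of \<open>f\<close> has a connected image that misses
  \<open>c\<close>.\<close>

lemma eventually_one_side:
  fixes f :: "real \<Rightarrow> real"
  assumes cont: "continuous_on {a..} f" and ne: "\<forall>\<^sub>F t in at_top. f t \<noteq> c"
  shows "(\<forall>\<^sub>F t in at_top. f t < c) \<or> (\<forall>\<^sub>F t in at_top. f t > c)"
proof -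
  obtain T0 where T0: "\<And>t. t \<ge> T0 \<Longrightarrow> f t \<noteq> c"
    using ne by (auto simp: eventually_at_top_linorder)
  define T where "T = max a T0"
  have conn: "connected (f ` {T..})"
    by (rule connected_continuous_image[OF continuous_on_subset[OF cont]])
      (auto simp: T_def)
  have "f u < c \<longleftrightarrow> f t < c" if "u \<ge> T" "t \<ge> T" for u t
  proof (rule ccontr)
    assume *: "\<not> (f u < c \<longleftrightarrow> f t < c)"
    have "c \<in> f ` {T..}"
    proof (cases "f u < c")
      case True
      then show ?thesis
        using * that connectedD_interval[OF conn, of "f u" "f t" c] by auto
    next
      case False
      then show ?thesis
        using * that connectedD_interval[OF conn, of "f t" "f u" c] by auto
    qed
    then obtain r where "r \<ge> T" "f r = c" by auto
    then show False using T0[of r] by (simp add: T_def)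
  qed
  then have "(\<forall>t\<ge>T. f t < c) \<or> (\<forall>t\<ge>T. \<not> f t < c)" by blast
  then show ?thesis
    using T0 unfolding eventually_at_top_linorder T_def
    by (metis max.cobounded2 not_less_iff_gr_or_eq order_trans)
qed

text \<open>If the lower limit were strictly below the upper limit, continuity would force
  \<open>f\<close> to return forever to every value in between, but some value in that gap is
  eventually avoided.\<close>

lemma tendsto_if_avoids_dense_values:
  fixes f :: "real \<Rightarrow> real"
  assumes cont: "continuous_on {a..} f"
    and bound: "\<And>t. a \<le> t \<Longrightarrow> \<bar>f t\<bar> \<le> B"
    and avoid: "\<And>p q. p < q \<Longrightarrow> \<exists>c. p < c \<and> c < q \<and> (\<forall>\<^sub>F t in at_top. f t \<noteq> c)"
  obtains L where "(f \<longlongrightarrow> L) at_top"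
proof -
  \<comment> \<open>\<open>S\<close> collects the eventual strict lower bounds, so
    \<open>Sup S\<close> is the lower limit of \<open>f\<close>.\<close>
  define S where "S = {c. \<forall>\<^sub>F t in at_top. f t > c}"
  have "- B - 1 < f t" if "t \<ge> a" for t using bound[OF that] by simp
  then have ne: "- B - 1 \<in> S"
    by (auto simp: S_def eventually_at_top_linorder)
  have "c \<le> B" if c: "c \<in> S" for c
  proof -
    obtain T where "\<forall>t\<ge>T. f t > c"
      using c by (auto simp: S_def eventually_at_top_linorder)
    from this[rule_format, of "max T a"] bound[of "max T a"] show ?thesis by simp
  qed
  then have bdd: "bdd_above S" by (rule bdd_aboveI)
  have "(f \<longlongrightarrow> Sup S) at_top"
  proof (rule order_tendstoI)
    fix b assume "b < Sup S"
    then obtain c where "c \<in> S" "b < c" using less_cSup_iff[OF _ bdd, of b] ne by auto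
    then show "\<forall>\<^sub>F t in at_top. b < f t"
      by (auto simp: S_def elim: eventually_mono)
  next
    \<comment> \<open>An avoided \<open>c\<close> between \<open>Sup S\<close> and \<open>b\<close>
      has \<open>f\<close> eventually on one side of it. The side above is excluded because then
      \<open>c\<close> would belong to \<open>S\<close>.\<close>
    fix b assume "Sup S < b"
    then obtain c where c: "Sup S < c" "c < b" "\<forall>\<^sub>F t in at_top. f t \<noteq> c"
      using avoid by blast
    have "c \<notin> S" using c(1) cSup_upper[OF _ bdd, of c] by auto
    then have "\<forall>\<^sub>F t in at_top. f t < c"
      using eventually_one_side[OF cont c(3)] by (auto simp: S_def)
    then show "\<forall>\<^sub>F t in at_top. f t < b"
      using c(2) by (auto elim: eventually_mono)
  qed
  then show thesis by (rule that)
qed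

section \<open>Passing between Lebesgue and gauge integrals\<close>

text \<open>Integral edges are defined by Lebesgue integrals, while solutions are expressed by gauge
  integrals; on compact intervals the two agree for bounded Borel functions.\<close>

lemma bounded_borel_has_integral_Icc:
  fixes h :: "real \<Rightarrow> real"
  assumes meas: "h \<in> borel_measurable borel"
    and h: "\<And>t. 0 \<le> h t" "\<And>t. h t \<le> A"
  shows "integrable lborel (\<lambda>t. h t * indicator {p..q} t)" (is ?int)
    and "(h has_integral (LINT t|lborel. h t * indicator {p..q} t)) {p..q}"
proof -
  show int: ?int
  proof (rule Bochner_Integration.integrable_bound)
    show "integrable lborel (\<lambda>t. A * indicator {p..q} t :: real)"
      by (intro integrable_mult_right integrable_real_indicator)
        (auto simp: emeasure_lborel_Icc_eq)
    show "(\<lambda>t. h t * indicator {p..q} t) \<in> borel_measurable lborel"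
      using meas by measurable
  qed (use h in \<open>auto simp: indicator_def intro: order_trans[OF _ abs_ge_self]\<close>)
  have "((\<lambda>t. if t \<in> {p..q} then h t else 0) has_integral
      (LINT t|lborel. h t * indicator {p..q} t)) UNIV"
    using has_integral_integral_lborel[OF int]
    by (rule has_integral_eq[rotated]) (auto simp: indicator_def)
  then show "(h has_integral (LINT t|lborel. h t * indicator {p..q} t)) {p..q}"
    by (simp only: has_integral_restrict_UNIV)
qed

text \<open>Monotone convergence over the intervals \<open>{T..T + real n}\<close> bounds the tail
  by \<open>B\<close>, and boundedness of \<open>h\<close> makes the initial piece finite. This is
  what will contradict an integral edge.\<close>

lemma nn_integral_finite_if_integrals_bounded:
  fixes h :: "real \<Rightarrow> real"
  assumes meas: "h \<in> borel_measurable borel"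
    and h: "\<And>t. 0 \<le> h t" "\<And>t. h t \<le> A"
    and bound: "\<And>t. T \<le> t \<Longrightarrow> integral {T..t} h \<le> B"
    and "0 \<le> T"
  shows "(\<integral>\<^sup>+ t. ennreal (h t) * indicator {0..} t \<partial>lborel) < \<infinity>"
proof -
  note int = bounded_borel_has_integral_Icc(1)[of h, OF meas h]
  note hasint = bounded_borel_has_integral_Icc(2)[of h, OF meas h]
  have nn: "(\<integral>\<^sup>+ t. ennreal (h t) * indicator {p..q} t \<partial>lborel) = ennreal (integral {p..q} h)"
    for p q
  proof -
    have "(\<integral>\<^sup>+ t. ennreal (h t) * indicator {p..q} t \<partial>lborel)
        = (\<integral>\<^sup>+ t. ennreal (h t * indicator {p..q} t) \<partial>lborel)"
      by (intro nn_integral_cong) (auto simp: indicator_def)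
    also have "\<dots> = ennreal (LINT t|lborel. h t * indicator {p..q} t)"
      by (rule nn_integral_eq_integral[OF int]) (use h in auto)
    finally show ?thesis using integral_unique[OF hasint[of p q]] by simp
  qed
  have tail: "(\<integral>\<^sup>+ t. ennreal (h t) * indicator {T..} t \<partial>lborel) \<le> ennreal B"
  proof -
    have lim: "(SUP n. ennreal (h t) * indicator {T..T + real n} t)
        = ennreal (h t) * indicator {T..} t" for t
    proof (rule antisym)
      show "(SUP n. ennreal (h t) * indicator {T..T + real n} t)
          \<le> ennreal (h t) * indicator {T..} t"
        by (intro SUP_least mult_left_mono) (auto simp: indicator_def)
      obtain n where "t - T \<le> real n" using real_arch_simple by blast
      then have "ennreal (h t) * indicator {T..} t = ennreal (h t) * indicator {T..T + real n} t"
        by (auto simp: indicator_def)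
      then show "ennreal (h t) * indicator {T..} t
          \<le> (SUP n. ennreal (h t) * indicator {T..T + real n} t)"
        by (auto intro: SUP_upper2[of n])
    qed
    have "(\<integral>\<^sup>+ t. ennreal (h t) * indicator {T..} t \<partial>lborel)
        = (\<integral>\<^sup>+ t. (SUP n. ennreal (h t) * indicator {T..T + real n} t) \<partial>lborel)"
      by (simp only: lim)
    also have "\<dots> = (SUP n. \<integral>\<^sup>+ t. ennreal (h t) * indicator {T..T + real n} t \<partial>lborel)"
    proof (rule nn_integral_monotone_convergence_SUP)
      show "incseq (\<lambda>n t. ennreal (h t) * indicator {T..T + real n} t)"
        by (auto simp: incseq_def le_fun_def indicator_def)
    qed (use meas in measurable)
    also have "\<dots> \<le> ennreal B"
      unfolding nn by (intro SUP_least ennreal_leI bound) simp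
    finally show ?thesis .
  qed
  have "(\<integral>\<^sup>+ t. ennreal (h t) * indicator {0..} t \<partial>lborel)
      \<le> (\<integral>\<^sup>+ t. ennreal (h t) * indicator {0..T} t + ennreal (h t) * indicator {T..} t \<partial>lborel)"
    by (intro nn_integral_mono) (auto simp: indicator_def)
  also have "\<dots> = (\<integral>\<^sup>+ t. ennreal (h t) * indicator {0..T} t \<partial>lborel)
      + (\<integral>\<^sup>+ t. ennreal (h t) * indicator {T..} t \<partial>lborel)"
    by (rule nn_integral_add) (use meas in measurable)
  also have "\<dots> \<le> ennreal (integral {0..T} h) + ennreal B"
    unfolding nn by (intro add_left_mono tail)
  also have "\<dots> < \<infinity>" by simp
  finally show "(\<integral>\<^sup>+ t. ennreal (h t) * indicator {0..} t \<partial>lborel) < \<infinity>" .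
qed

section \<open>Conservation, symmetry and Lipschitz estimates along a solution\<close>

locale saturated_network =
  fixes \<alpha> :: "'n::finite \<Rightarrow> 'n \<Rightarrow> real \<Rightarrow> real"
    and s :: "'n \<Rightarrow> real"
    and x :: "real \<Rightarrow> 'n \<Rightarrow> real"
    and t0 A :: real
  assumes s_pos: "s i > 0"
    and weight_sym: "\<alpha> i j t = \<alpha> j i t"
    and weight_nonneg: "t \<ge> 0 \<Longrightarrow> 0 \<le> \<alpha> i j t"
    and weight_le: "t \<ge> 0 \<Longrightarrow> \<alpha> i j t \<le> A"
    and t0: "t0 \<ge> 0"
    and sol: "caratheodory_solution \<alpha> s t0 x"
begin

abbreviation y :: "real \<Rightarrow> 'n \<Rightarrow> real"
  where "y t i \<equiv> sat (s i) (x t i)"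

lemma y_eq: "y t i = max (- s i) (min (x t i) (s i))"
  by (rule sat_eq_clamp[OF s_pos])

lemma abs_y_le: "\<bar>y t i\<bar> \<le> s i"
  using s_pos[of i] by (auto simp: y_eq)

lemma A_nonneg: "0 \<le> A"
  using weight_nonneg[of 0] weight_le[of 0] by (meson order.refl order_trans)

text \<open>Saturation is odd, so the dynamics commutes with negation. Every one-sided estimate
  below thereby also yields its mirror image.\<close>

lemma saturated_network_uminus: "saturated_network \<alpha> s (\<lambda>t i. - x t i) t0 A"
proof unfold_locales
  have rhs: "sat_rhs \<alpha> s (\<lambda>t i. - x t i) i = (\<lambda>\<tau>. - sat_rhs \<alpha> s x i \<tau>)" for i
    unfolding sat_rhs_def sat_uminus sum_negf[symmetric]
    by (intro ext sum.cong refl) (simp add: algebra_simps)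
  show "caratheodory_solution \<alpha> s t0 (\<lambda>t i. - x t i)"
    unfolding caratheodory_solution_def
  proof (intro allI impI conjI)
    fix i t assume "t0 \<le> t"
    then have *: "sat_rhs \<alpha> s x i absolutely_integrable_on {t0..t}"
      "x t i = x t0 i + integral {t0..t} (sat_rhs \<alpha> s x i)"
      using sol unfolding caratheodory_solution_def by blast+
    show "sat_rhs \<alpha> s (\<lambda>t i. - x t i) i absolutely_integrable_on {t0..t}"
      using *(1) by (simp add: rhs set_integrable_def)
    show "- x t i = - x t0 i + integral {t0..t} (sat_rhs \<alpha> s (\<lambda>t i. - x t i) i)"
      unfolding rhs using *(2) by simp
  qed
qed (use s_pos weight_sym weight_nonneg weight_le t0 in auto)

lemma increment_has_integral:
  assumes "t0 \<le> u" "u \<le> t"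
  shows "(sat_rhs \<alpha> s x i has_integral (x t i - x u i)) {u..t}"
proof -
  have "sat_rhs \<alpha> s x i absolutely_integrable_on {t0..t}"
    and eq: "x t i = x t0 i + integral {t0..t} (sat_rhs \<alpha> s x i)"
      "x u i = x t0 i + integral {t0..u} (sat_rhs \<alpha> s x i)"
    using sol assms order_trans[OF assms] unfolding caratheodory_solution_def by blast+
  then have int: "sat_rhs \<alpha> s x i integrable_on {t0..t}"
    by (simp add: absolutely_integrable_on_def)
  have "integral {t0..u} (sat_rhs \<alpha> s x i) + integral {u..t} (sat_rhs \<alpha> s x i)
      = integral {t0..t} (sat_rhs \<alpha> s x i)"
    by (rule Henstock_Kurzweil_Integration.integral_combine[OF assms int])
  moreover have "sat_rhs \<alpha> s x i integrable_on {u..t}"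
    by (rule integrable_on_subinterval[OF int]) (use assms in auto)
  ultimately show ?thesis using eq by (simp add: has_integral_iff)
qed

lemma sum_increment_has_integral:
  assumes "t0 \<le> u" "u \<le> t"
  shows "((\<lambda>\<tau>. \<Sum>i\<in>P. sat_rhs \<alpha> s x i \<tau>) has_integral (\<Sum>i\<in>P. x t i - x u i)) {u..t}"
  by (intro has_integral_sum increment_has_integral assms) auto

text \<open>By symmetry of the weights the exchanges inside \<open>P\<close> cancel in pairs,
  leaving only the flow across the cut. For \<open>P = UNIV\<close> no flow is left, which gives
  conservation of the total.\<close>

lemma sum_rhs_eq_cut_flow:
  "(\<Sum>i\<in>P. sat_rhs \<alpha> s x i \<tau>) = (\<Sum>i\<in>P. \<Sum>j\<in>-P. \<alpha> i j \<tau> * (y \<tau> j - y \<tau> i))"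
proof -
  let ?f = "\<lambda>i j. \<alpha> i j \<tau> * (y \<tau> j - y \<tau> i)"
  have "(\<Sum>i\<in>P. \<Sum>j\<in>P. ?f i j) = (\<Sum>j\<in>P. \<Sum>i\<in>P. ?f i j)"
    by (rule sum.swap)
  also have "\<dots> = (\<Sum>j\<in>P. \<Sum>i\<in>P. - ?f j i)"
    by (intro sum.cong refl) (metis minus_diff_eq mult_minus_right weight_sym)
  finally have internal: "(\<Sum>i\<in>P. \<Sum>j\<in>P. ?f i j) = 0"
    by (simp add: sum_negf)
  have "(\<Sum>j\<in>UNIV. ?f i j) = (\<Sum>j\<in>P. ?f i j) + (\<Sum>j\<in>-P. ?f i j)" for i
    using sum.union_disjoint[of P "-P" "?f i"] by simp
  then show ?thesis
    by (simp add: sat_rhs_def sum.distrib internal)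
qed

lemma total_conserved:
  assumes "t0 \<le> t"
  shows "(\<Sum>i\<in>UNIV. x t i) = (\<Sum>i\<in>UNIV. x t0 i)"
proof -
  have "((\<lambda>\<tau>. 0) has_integral (\<Sum>i\<in>UNIV. x t i - x t0 i)) {t0..t}"
    using sum_increment_has_integral[of t0 t UNIV] assms
    by (simp add: sum_rhs_eq_cut_flow)
  then have "(\<Sum>i\<in>UNIV. x t i - x t0 i) = 0"
    using has_integral_0 has_integral_unique by blast
  then show ?thesis by (simp add: sum_subtractf)
qed

text \<open>Weights are at most \<open>A\<close> and outputs differ by at most
  \<open>s j + s i\<close>. Summing over \<open>i\<close> as well gives a single rate valid for all
  agents.\<close>

definition speed :: real
  where "speed = (\<Sum>i\<in>UNIV. \<Sum>j\<in>UNIV. A * (s j + s i))"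

lemma speed_nonneg: "0 \<le> speed"
  unfolding speed_def using A_nonneg s_pos
  by (intro sum_nonneg mult_nonneg_nonneg add_nonneg_nonneg) (auto intro: less_imp_le)

lemma abs_sat_rhs_le:
  assumes "0 \<le> \<tau>"
  shows "\<bar>sat_rhs \<alpha> s x i \<tau>\<bar> \<le> speed"
proof -
  have nn: "0 \<le> A * (s j + s i)" for i j
    using A_nonneg s_pos[of i] s_pos[of j] by simp
  have "\<bar>sat_rhs \<alpha> s x i \<tau>\<bar> \<le> (\<Sum>j\<in>UNIV. \<bar>\<alpha> i j \<tau> * (y \<tau> j - y \<tau> i)\<bar>)"
    unfolding sat_rhs_def by (rule sum_abs)
  also have "\<dots> \<le> (\<Sum>j\<in>UNIV. A * (s j + s i))"
  proof (rule sum_mono)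
    fix j
    have "\<bar>y \<tau> j - y \<tau> i\<bar> \<le> s j + s i"
      using abs_y_le[of j \<tau>] abs_y_le[of i \<tau>] by linarith
    then show "\<bar>\<alpha> i j \<tau> * (y \<tau> j - y \<tau> i)\<bar> \<le> A * (s j + s i)"
      unfolding abs_mult using assms weight_nonneg weight_le A_nonneg
      by (intro mult_mono) auto
  qed
  also have "\<dots> \<le> speed"
    unfolding speed_def by (rule member_le_sum) (auto intro!: sum_nonneg nn)
  finally show ?thesis .
qed

lemma x_lipschitz:
  assumes "t0 \<le> u" "u \<le> t"
  shows "\<bar>x t i - x u i\<bar> \<le> speed * (t - u)"
proof -
  have "norm (sat_rhs \<alpha> s x i \<tau>) \<le> speed" if "\<tau> \<in> {u..t}" for \<tau>
    using abs_sat_rhs_le[of \<tau> i] that assms t0 by simp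
  then have "norm (x t i - x u i) \<le> speed * measure lborel {u..t}"
    by (intro has_integral_bound_real[OF speed_nonneg finite.emptyI
          increment_has_integral[OF assms]]) auto
  then show ?thesis using assms by simp
qed

lemma y_lipschitz:
  assumes "t0 \<le> u" "u \<le> t"
  shows "\<bar>y t i - y u i\<bar> \<le> speed * (t - u)"
  using x_lipschitz[OF assms, of i] s_pos[of i] unfolding y_eq by linarith

lemma continuous_x: "continuous_on {t0..} (\<lambda>t. x t i)"
proof -
  have "dist (x t i) (x u i) \<le> speed * dist t u" if "t0 \<le> t" "t0 \<le> u" for t u
    using x_lipschitz[of t u i] x_lipschitz[of u t i] that
    by (cases "t \<le> u") (auto simp: dist_real_def abs_minus_commute)
  then have "speed-lipschitz_on {t0..} (\<lambda>t. x t i)"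
    by (intro lipschitz_onI speed_nonneg) auto
  then show ?thesis by (rule lipschitz_on_continuous_on)
qed

lemma continuous_y: "continuous_on {t0..} (\<lambda>t. y t i)"
  unfolding y_eq by (intro continuous_intros continuous_x)

section \<open>The excess above a threshold: monotonicity, bounds and avoided values\<close>

text \<open>For \<open>c \<ge> 0\<close>, an agent with \<open>s i > c\<close> has
  \<open>x t i > c\<close> exactly when its output exceeds \<open>c\<close>, whereas an agent with
  \<open>s i \<le> c\<close> never has output above \<open>c\<close>. The restriction on the index
  thus makes the positive summands match the upper side of the output cut.\<close>

definition excess :: "real \<Rightarrow> real \<Rightarrow> real"
  where "excess c t = (\<Sum>i | c < s i. max 0 (x t i - c))"

text \<open>\<open>excess\<close> is only piecewise smooth along solutions; freezing the cut at time \<open>t\<close> costs an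
  error quadratic in \<open>t - u\<close>, which vanishes under subdivision.\<close>

lemma excess_quadratic_increment:
  assumes "0 \<le> c" and ut: "t0 \<le> u" "u \<le> t"
  shows "excess c t - excess c u
    \<le> (\<Sum>i\<in>(UNIV::'n set). \<Sum>j\<in>(UNIV::'n set). A * (2 * speed)) * (t - u)\<^sup>2"
proof -
  define P where "P = {i. c < s i \<and> c < x t i}"
  define M where "M = (\<Sum>i\<in>(UNIV::'n set). \<Sum>j\<in>(UNIV::'n set). A * (2 * speed * (t - u)))"
  have nn: "0 \<le> A * (2 * speed * (t - u))"
    using A_nonneg speed_nonneg ut by simp
  have "excess c t - excess c u
      = (\<Sum>i | c < s i. max 0 (x t i - c) - max 0 (x u i - c))"
    by (simp add: excess_def sum_subtractf)
  \<comment> \<open>Convexity of the positive part: a subgradient taken at the final time bounds the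
    increment.\<close>
  also have "\<dots> \<le> (\<Sum>i | c < s i. if c < x t i then x t i - x u i else 0)"
    by (rule sum_mono) auto
  also have "\<dots> = (\<Sum>i\<in>P. x t i - x u i)"
    unfolding P_def by (subst sum.inter_filter[symmetric]) (auto simp: conj_commute)
  also have "\<dots> \<le> M * (t - u)"
  proof -
    have flow: "(\<Sum>i\<in>P. sat_rhs \<alpha> s x i \<tau>) \<le> M" if \<tau>: "\<tau> \<in> {u..t}" for \<tau>
    proof -
      have "\<alpha> i j \<tau> * (y \<tau> j - y \<tau> i) \<le> A * (2 * speed * (t - u))"
        if "i \<in> P" "j \<in> -P" for i j
      proof -
        \<comment> \<open>At time \<open>t\<close> the outputs are ordered across the cut. Going
          back to \<open>\<tau>\<close> moves each of the two by at most
          \<open>speed * (t - u)\<close>, whence the factor 2.\<close>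
        have "y t i \<ge> c" using \<open>i \<in> P\<close> s_pos[of i] by (auto simp: P_def y_eq)
        moreover have "y t j \<le> c"
          using \<open>j \<in> -P\<close> s_pos[of j] \<open>0 \<le> c\<close> by (auto simp: P_def y_eq)
        moreover have "speed * (t - \<tau>) \<le> speed * (t - u)"
          using \<tau> speed_nonneg by (intro mult_left_mono) auto
        ultimately have "y \<tau> j - y \<tau> i \<le> 2 * speed * (t - u)"
          using y_lipschitz[of \<tau> t i] y_lipschitz[of \<tau> t j] \<tau> ut by auto
        moreover have "0 \<le> \<alpha> i j \<tau>" "\<alpha> i j \<tau> \<le> A"
          using weight_nonneg weight_le \<tau> ut t0 by auto
        ultimately have "\<alpha> i j \<tau> * (y \<tau> j - y \<tau> i) \<le> \<alpha> i j \<tau> * (2 * speed * (t - u))"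
          by (intro mult_left_mono)
        also have "\<dots> \<le> A * (2 * speed * (t - u))"
          using \<open>\<alpha> i j \<tau> \<le> A\<close> speed_nonneg ut by (intro mult_right_mono) auto
        finally show ?thesis .
      qed
      then have "(\<Sum>i\<in>P. sat_rhs \<alpha> s x i \<tau>) \<le> (\<Sum>i\<in>P. \<Sum>j\<in>-P. A * (2 * speed * (t - u)))"
        unfolding sum_rhs_eq_cut_flow by (intro sum_mono) auto
      also have "\<dots> \<le> (\<Sum>i\<in>P. \<Sum>j\<in>(UNIV::'n set). A * (2 * speed * (t - u)))"
        using nn by (intro sum_mono sum_mono2) auto
      also have "\<dots> \<le> M"
        unfolding M_def using nn by (intro sum_mono2 sum_nonneg) auto
      finally show ?thesis .
    qed
    have "(\<Sum>i\<in>P. x t i - x u i) \<le> M * measure lborel {u..t}"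
      by (rule has_integral_le[OF sum_increment_has_integral[OF ut]])
        (use flow has_integral_const_real[of M u t] ut in \<open>auto simp: mult.commute\<close>)
    then show ?thesis using ut by simp
  qed
  finally show ?thesis
    by (simp add: M_def power2_eq_square algebra_simps)
qed

lemma excess_antimono:
  assumes "0 \<le> c" "t0 \<le> u" "u \<le> t"
  shows "excess c t \<le> excess c u"
  by (rule antimono_if_quadratic_increments[OF excess_quadratic_increment])
    (use assms in auto)

lemma excess_nonneg: "0 \<le> excess c t"
  unfolding excess_def by (intro sum_nonneg) auto

lemma excess_convergent:
  assumes "0 \<le> c"
  obtains L where "(excess c \<longlongrightarrow> L) at_top"
  by (rule antimono_bounded_below_tendsto[OF excess_antimono[OF assms] excess_nonneg])

text \<open>At threshold 0 every agent is counted, so the initial excess dominates each state at all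
  later times.\<close>

lemma x_le_excess:
  assumes "t0 \<le> t"
  shows "x t i \<le> excess 0 t0"
proof -
  have "x t i \<le> max 0 (x t i - 0)" by simp
  also have "\<dots> \<le> excess 0 t"
    unfolding excess_def using s_pos by (intro member_le_sum) auto
  also have "\<dots> \<le> excess 0 t0"
    using excess_antimono assms by simp
  finally show ?thesis .
qed

lemma x_bounded: "\<exists>B. \<forall>t\<ge>t0. \<forall>i. \<bar>x t i\<bar> \<le> B"
proof -
  interpret neg: saturated_network \<alpha> s "\<lambda>t i. - x t i" t0 A
    by (rule saturated_network_uminus)
  have "\<bar>x t i\<bar> \<le> max (excess 0 t0) (neg.excess 0 t0)" if "t0 \<le> t" for t i
    using x_le_excess[OF that, of i] neg.x_le_excess[OF that, of i] by linarith
  then show ?thesis by blast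
qed

text \<open>Second differences of \<open>excess\<close> in the threshold are sums of tent functions, hence
  converge. Among more than \<open>CARD('n)\<close> disjoint tents, one must eventually be empty.\<close>

lemma eventually_avoids_threshold:
  assumes "0 \<le> p" "p < q" and no_level: "\<And>i. s i \<notin> {p..q}"
  obtains c where "p < c" "c < q"
    "\<forall>\<^sub>F t in at_top. \<forall>i. p < s i \<longrightarrow> x t i \<noteq> c"
proof -
  define N where "N = CARD('n)"
  \<comment> \<open>The N + 1 tents of half-width \<open>d\<close>, centred at \<open>c 0\<close>,
    ..., \<open>c N\<close>, exactly tile the interval from \<open>p\<close> to \<open>q\<close>;
    there is one more tent than there are agents.\<close>
  define d where "d = (q - p) / (2 * (real N + 1))"
  define c where "c k = p + (2 * real k + 1) * d" for k
  define tent where "tent k v = max 0 (d - \<bar>v - c k\<bar>)" for k v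
  define mass where "mass k t = (\<Sum>i | p < s i. tent k (x t i))" for k t
  have d: "d > 0" and dq: "2 * (real N + 1) * d = q - p"
    using assms by (auto simp: d_def)
  have c: "p \<le> c k - d" "c k + d \<le> q" if "k \<le> N" for k
  proof -
    have "2 * real k * d \<le> 2 * real N * d"
      using that d by simp
    then show "p \<le> c k - d" "c k + d \<le> q"
      using d dq by (auto simp: c_def algebra_simps)
  qed
  \<comment> \<open>Without a level in the interval, the excesses at all thresholds there range over
    the same agents, so their second differences can be formed agent by agent.\<close>
  have level: "{i. v < s i} = {i. p < s i}" if "p \<le> v" "v \<le> q" for v
  proof -
    have "v < s i \<longleftrightarrow> p < s i" for i
      using no_level[of i] that by auto
    then show ?thesis by simp
  qed
  have "\<exists>L. (mass k \<longlongrightarrow> L) at_top" if k: "k \<le> N" for k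
  proof -
    have sets: "{i. c k - d < s i} = {i. p < s i}" "{i. c k < s i} = {i. p < s i}"
      "{i. c k + d < s i} = {i. p < s i}"
      using c[OF k] d by (intro level; simp)+
    have "tent k v = max 0 (v - (c k - d)) + max 0 (v - (c k + d)) - 2 * max 0 (v - c k)" for v
      using d by (auto simp: tent_def max_def)
    then have "mass k t = excess (c k - d) t + excess (c k + d) t - 2 * excess (c k) t" for t
      by (simp add: mass_def excess_def sets sum.distrib sum_subtractf sum_distrib_left)
    then have eq: "mass k = (\<lambda>t. excess (c k - d) t + excess (c k + d) t - 2 * excess (c k) t)"
      by blast
    obtain L1 where L1: "(excess (c k - d) \<longlongrightarrow> L1) at_top"
      by (rule excess_convergent[of "c k - d"]) (use c[OF k] d \<open>0 \<le> p\<close> in auto)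
    obtain L2 where L2: "(excess (c k + d) \<longlongrightarrow> L2) at_top"
      by (rule excess_convergent[of "c k + d"]) (use c[OF k] d \<open>0 \<le> p\<close> in auto)
    obtain L3 where L3: "(excess (c k) \<longlongrightarrow> L3) at_top"
      by (rule excess_convergent[of "c k"]) (use c[OF k] d \<open>0 \<le> p\<close> in auto)
    show ?thesis
      unfolding eq
      using tendsto_diff[OF tendsto_add[OF L1 L2] tendsto_mult[OF tendsto_const L3]] by blast
  qed
  then obtain L where L: "\<And>k. k \<le> N \<Longrightarrow> (mass k \<longlongrightarrow> L k) at_top"
    by metis
  \<comment> \<open>Pigeonhole: if all limits were positive, at some time every tent would contain a
    state, and disjointness would assign N + 1 different agents to the tents.\<close>
  have "\<exists>k\<le>N. L k \<le> 0"
  proof (rule ccontr)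
    assume "\<not> (\<exists>k\<le>N. L k \<le> 0)"
    then have "\<forall>\<^sub>F t in at_top. \<forall>k\<in>{..N}. 0 < mass k t"
      using L by (intro eventually_ball_finite ballI order_tendstoD(1)) auto
    then obtain t where t: "\<And>k. k \<le> N \<Longrightarrow> 0 < mass k t"
      by (auto simp: eventually_at_top_linorder)
    have "\<exists>i. \<bar>x t i - c k\<bar> < d" if "k \<le> N" for k
    proof (rule ccontr)
      assume "\<nexists>i. \<bar>x t i - c k\<bar> < d"
      then have "mass k t = 0"
        unfolding mass_def tent_def by (intro sum.neutral) (auto simp: not_less)
      with t[OF that] show False by simp
    qed
    then obtain J where J: "\<And>k. k \<le> N \<Longrightarrow> \<bar>x t (J k) - c k\<bar> < d"
      by metis
    have "inj_on J {..N}"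
    proof (rule linorder_inj_onI')
      fix k l assume kl: "k \<in> {..N}" "l \<in> {..N}" "k < l"
      have "2 * d * (real k + 1) \<le> 2 * d * real l"
        using d kl by (intro mult_left_mono) auto
      then have "c k + d \<le> c l - d"
        by (simp add: c_def algebra_simps)
      then show "J k \<noteq> J l"
        using J[of k] J[of l] kl by auto
    qed
    then have "card {..N} \<le> N"
      unfolding N_def by (intro card_inj_on_le) auto
    then show False by simp
  qed
  then obtain k where k: "k \<le> N" "L k \<le> 0" by blast
  have "\<forall>\<^sub>F t in at_top. mass k t < d"
    using order_tendstoD(2)[OF L[OF k(1)]] k(2) d by auto
  then have "\<forall>\<^sub>F t in at_top. \<forall>i. p < s i \<longrightarrow> x t i \<noteq> c k"
  proof (rule eventually_mono, intro allI impI)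
    fix t i assume t: "mass k t < d" and i: "p < s i"
    \<comment> \<open>A state sitting at the centre \<open>c k\<close> would alone contribute the
      full height \<open>d\<close>.\<close>
    have "tent k (x t i) \<le> mass k t"
      unfolding mass_def using i by (intro member_le_sum) (auto simp: tent_def)
    then show "x t i \<noteq> c k" using t d by (auto simp: tent_def)
  qed
  then show thesis
    using that[of "c k"] c[OF k(1)] d by auto
qed

section \<open>Convergence of the outputs\<close>

text \<open>The avoided values are dense: negative values and values above \<open>s i\<close> are
  never taken, and between 0 and \<open>s i\<close> the threshold lemma applies on subintervals free
  of levels.\<close>

lemma positive_part_convergent: "\<exists>L. ((\<lambda>t. max 0 (y t i)) \<longlongrightarrow> L) at_top"
proof -
  have "\<exists>c. p < c \<and> c < q \<and> (\<forall>\<^sub>F t in at_top. max 0 (y t i) \<noteq> c)" if pq0: "p < q" for p q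
  proof -
    consider "p < 0" | "0 \<le> p" "s i < q" | "0 \<le> p" "q \<le> s i" by linarith
    then show ?thesis
    proof cases
      case 1
      obtain c where "p < c" "c < min q 0"
        using dense[of p "min q 0"] 1 pq0 by auto
      moreover from this have "max 0 (y t i) \<noteq> c" for t by auto
      ultimately show ?thesis by (intro exI[of _ c]) auto
    next
      case 2
      obtain c where c: "max p (s i) < c" "c < q"
        using dense[of "max p (s i)" q] 2 pq0 by auto
      have "max 0 (y t i) \<noteq> c" for t
        using c s_pos[of i] by (auto simp: y_eq)
      then show ?thesis using c by (intro exI[of _ c]) auto
    next
      case 3
      \<comment> \<open>There are finitely many levels, so some closed ball inside the interval
        contains none of them.\<close>
      have "infinite ({p<..<q} - range s)"
        using pq0 by (simp add: Diff_infinite_finite)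
      then obtain r where r: "r \<in> {p<..<q} - range s"
        using infinite_imp_nonempty by blast
      have "open ({p<..<q} - range s)"
        by (intro open_Diff finite_imp_closed) auto
      then obtain e where e: "e > 0" "cball r e \<subseteq> {p<..<q} - range s"
        using r open_contains_cball by blast
      then have sub: "{r - e..r + e} \<subseteq> {p<..<q} - range s"
        by (simp add: cball_eq_atLeastAtMost)
      have "r - e \<in> {p<..<q}" "r + e \<in> {p<..<q}"
        by (rule subsetD[OF order_trans[OF sub Diff_subset]]; use e(1) in simp)+
      then have pq: "p < r - e" "r + e < q" by auto
      obtain c where c: "r - e < c" "c < r + e"
        "\<forall>\<^sub>F t in at_top. \<forall>j. r - e < s j \<longrightarrow> x t j \<noteq> c"
        by (rule eventually_avoids_threshold[of "r - e" "r + e"]) (use sub pq e 3 in auto)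
      have "max 0 (y t i) \<noteq> c" if "\<forall>j. r - e < s j \<longrightarrow> x t j \<noteq> c" for t
      proof -
        have "x t i \<noteq> c" using that pq 3 e by auto
        \<comment> \<open>Since \<open>c\<close> lies strictly between 0 and \<open>s i\<close>, the
          output equals \<open>c\<close> only if the state does.\<close>
        then show ?thesis using c pq 3 by (auto simp: y_eq max_def min_def)
      qed
      then have "\<forall>\<^sub>F t in at_top. max 0 (y t i) \<noteq> c"
        by (rule eventually_mono[OF c(3)])
      then show ?thesis using c pq by (intro exI[of _ c]) auto
    qed
  qed
  moreover have "continuous_on {t0..} (\<lambda>t. max 0 (y t i))"
    by (intro continuous_intros continuous_y)
  moreover have "\<bar>max 0 (y t i)\<bar> \<le> s i" for t
    using abs_y_le[of i t] s_pos[of i] by auto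
  ultimately show ?thesis
    using tendsto_if_avoids_dense_values[of t0 "\<lambda>t. max 0 (y t i)" "s i"] by blast
qed

text \<open>The excess controls only nonnegative thresholds. The negative part of the output is the
  positive part of the output of the negated solution.\<close>

lemma y_convergent: "\<exists>L. ((\<lambda>t. y t i) \<longlongrightarrow> L) at_top"
proof -
  interpret neg: saturated_network \<alpha> s "\<lambda>t i. - x t i" t0 A
    by (rule saturated_network_uminus)
  obtain L1 L2 where "((\<lambda>t. max 0 (y t i)) \<longlongrightarrow> L1) at_top"
    "((\<lambda>t. max 0 (neg.y t i)) \<longlongrightarrow> L2) at_top"
    using positive_part_convergent neg.positive_part_convergent by blast
  then have "((\<lambda>t. max 0 (y t i) - max 0 (neg.y t i)) \<longlongrightarrow> L1 - L2) at_top"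
    by (rule tendsto_diff)
  moreover have "max 0 (y t i) - max 0 (neg.y t i) = y t i" for t
    by (auto simp: sat_uminus)
  ultimately have "((\<lambda>t. y t i) \<longlongrightarrow> L1 - L2) at_top" by (simp only:)
  then show ?thesis by blast
qed

section \<open>Transport across integral edges\<close>

lemma limits_le_across_integral_edge:
  assumes cont: "Z \<in> null_sets lborel"
      "\<forall>t \<in> {0..} - Z. continuous (at t within {0..}) (\<alpha> a b)"
    and lim: "\<And>i. ((\<lambda>t. y t i) \<longlongrightarrow> L i) at_top"
    and bound: "\<And>t i. t0 \<le> t \<Longrightarrow> \<bar>x t i\<bar> \<le> B"
    and edge: "integral_edge \<alpha> a b"
  shows "L a \<le> L b"
proof (rule ccontr)
  assume "\<not> L a \<le> L b"
  \<comment> \<open>Cutting at the limit value \<open>L a\<close> makes every pair across the cut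
    eventually strictly ordered, so all cut edges drain \<open>P\<close> and none can offset the
    loss through the edge from \<open>a\<close> to \<open>b\<close>.\<close>
  define P where "P = {i. L a \<le> L i}"
  \<comment> \<open>Half the gap between the limits, hence eventually exceeded by the difference of
    the outputs.\<close>
  define e where "e = (L a - L b) / 2"
  have e: "e > 0" and ab: "a \<in> P" "b \<in> -P"
    using \<open>\<not> L a \<le> L b\<close> by (auto simp: e_def P_def)
  have "\<forall>\<^sub>F t in at_top. e < y t a - y t b"
    using order_tendstoD(1)[OF tendsto_diff[OF lim[of a] lim[of b]], of e] e
    by (auto simp: e_def)
  moreover have "\<forall>\<^sub>F t in at_top. \<forall>i\<in>P. \<forall>j\<in>-P. 0 < y t i - y t j"
    by (intro eventually_ball_finite ballI order_tendstoD(1)[OF tendsto_diff[OF lim lim]])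
      (auto simp: P_def)
  ultimately have "\<forall>\<^sub>F t in at_top. t0 \<le> t \<and> e < y t a - y t b \<and>
      (\<forall>i\<in>P. \<forall>j\<in>-P. 0 < y t i - y t j)"
    using eventually_ge_at_top[of t0] by eventually_elim auto
  then obtain T where T: "\<And>t. t \<ge> T \<Longrightarrow> t0 \<le> t" "\<And>t. t \<ge> T \<Longrightarrow> e < y t a - y t b"
      "\<And>t i j. t \<ge> T \<Longrightarrow> i \<in> P \<Longrightarrow> j \<in> -P \<Longrightarrow> 0 < y t i - y t j"
    unfolding eventually_at_top_linorder by blast
  have flow: "e * \<alpha> a b \<tau> \<le> - (\<Sum>i\<in>P. sat_rhs \<alpha> s x i \<tau>)" if \<tau>: "\<tau> \<ge> T" for \<tau>
  proof -
    let ?g = "\<lambda>i j. \<alpha> i j \<tau> * (y \<tau> i - y \<tau> j)"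
    have w: "0 \<le> \<alpha> i j \<tau>" for i j
      using weight_nonneg T(1)[OF \<tau>] t0 by simp
    have g: "0 \<le> ?g i j" if "i \<in> P" "j \<in> -P" for i j
      using T(3)[OF \<tau> that] w by (intro mult_nonneg_nonneg) auto
    have "e * \<alpha> a b \<tau> \<le> ?g a b"
      using mult_left_mono[OF less_imp_le[OF T(2)[OF \<tau>]] w[of a b]]
      by (simp add: mult.commute)
    also have "\<dots> \<le> (\<Sum>j\<in>-P. ?g a j)"
      using ab g by (intro member_le_sum) auto
    also have "\<dots> \<le> (\<Sum>i\<in>P. \<Sum>j\<in>-P. ?g i j)"
      using ab g by (intro member_le_sum[of a P "\<lambda>i. \<Sum>j\<in>-P. ?g i j"] sum_nonneg) auto
    also have "\<dots> = - (\<Sum>i\<in>P. sat_rhs \<alpha> s x i \<tau>)"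
      unfolding sum_rhs_eq_cut_flow sum_negf[symmetric]
      by (intro sum.cong refl) (simp add: algebra_simps)
    finally show ?thesis .
  qed
  \<comment> \<open>Setting the weight to zero on negative times and on the null set
    \<open>Z\<close> leaves a bounded Borel function that agrees with the weight almost everywhere
    on the half-line.\<close>
  define h where "h t = indicator ({0..} - Z) t * \<alpha> a b t" for t
  have "continuous_on ({0..} - Z) (\<alpha> a b)"
    using cont(2) by (auto simp: continuous_on_eq_continuous_within intro: continuous_within_subset)
  then have meas: "h \<in> borel_measurable borel"
    using borel_measurable_continuous_on_indicator[of "{0..} - Z" "\<alpha> a b"] cont(1)
    by (auto simp: h_def[abs_def] null_sets_def)
  have h: "0 \<le> h t" "h t \<le> A" for t
    using weight_nonneg[of t a b] weight_le[of t a b] A_nonneg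
    by (auto simp: h_def indicator_def)
  have "integral {T..t} h \<le> (\<Sum>i\<in>P. 2 * B) / e" if t: "T \<le> t" for t
  proof -
    have "(h has_integral integral {T..t} h) {T..t}"
      using bounded_borel_has_integral_Icc(2)[OF meas h, where p = T and q = t]
      by (auto simp: has_integral_iff)
    then have "((\<lambda>\<tau>. e * h \<tau>) has_integral e * integral {T..t} h) {T..t}"
      by (rule has_integral_mult_right)
    then have "e * integral {T..t} h \<le> - (\<Sum>i\<in>P. x t i - x T i)"
    proof (rule has_integral_le)
      show "((\<lambda>\<tau>. - (\<Sum>i\<in>P. sat_rhs \<alpha> s x i \<tau>)) has_integral
          - (\<Sum>i\<in>P. x t i - x T i)) {T..t}"
        by (intro has_integral_neg sum_increment_has_integral) (use T t in auto)
      fix \<tau> assume \<tau>: "\<tau> \<in> {T..t}"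
      have "h \<tau> \<le> \<alpha> a b \<tau>"
        using weight_nonneg[of \<tau> a b] T(1)[of \<tau>] \<tau> t0 by (auto simp: h_def indicator_def)
      then have "e * h \<tau> \<le> e * \<alpha> a b \<tau>" using e by simp
      also have "\<dots> \<le> - (\<Sum>i\<in>P. sat_rhs \<alpha> s x i \<tau>)" using flow \<tau> by simp
      finally show "e * h \<tau> \<le> - (\<Sum>i\<in>P. sat_rhs \<alpha> s x i \<tau>)" .
    qed
    also have "\<dots> = (\<Sum>i\<in>P. x T i - x t i)"
      by (simp add: sum_subtractf)
    also have "\<dots> \<le> (\<Sum>i\<in>P. 2 * B)"
    proof (rule sum_mono)
      fix i show "x T i - x t i \<le> 2 * B"
        using bound[of T i] bound[of t i] T(1)[of T] T(1)[of t] t by auto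
    qed
    finally show ?thesis using e by (simp add: pos_le_divide_eq mult.commute)
  qed
  then have "(\<integral>\<^sup>+ t. ennreal (h t) * indicator {0..} t \<partial>lborel) < \<infinity>"
    by (rule nn_integral_finite_if_integrals_bounded[OF meas h])
      (use T(1)[of T] t0 in auto)
  moreover have "(\<integral>\<^sup>+ t. ennreal (h t) * indicator {0..} t \<partial>lborel)
      = (\<integral>\<^sup>+ t. ennreal (\<alpha> a b t) * indicator {0..} t \<partial>lborel)"
  proof (rule nn_integral_cong_AE)
    show "AE t in lborel. ennreal (h t) * indicator {0..} t = ennreal (\<alpha> a b t) * indicator {0..} t"
      using AE_not_in[OF cont(1)] by eventually_elim (auto simp: h_def indicator_def)
  qed
  ultimately show False using edge by (simp add: integral_edge_def)
qed

text \<open>Symmetric weights make the edge relation symmetric, so the one-sided comparison gives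
  equality along edges and then along paths of the integral graph.\<close>

lemma limits_equal:
  assumes standing: "standing_assumptions \<alpha>" and conn: "integrally_connected \<alpha>"
    and lim: "\<And>i. ((\<lambda>t. y t i) \<longlongrightarrow> L i) at_top"
  shows "L i = L j"
proof -
  obtain B where B: "\<And>t i. t0 \<le> t \<Longrightarrow> \<bar>x t i\<bar> \<le> B"
    using x_bounded by blast
  have le: "L a \<le> L b" if edge: "integral_edge \<alpha> a b" for a b
  proof -
    obtain Z where "Z \<in> null_sets lborel"
      "\<forall>t \<in> {0..} - Z. continuous (at t within {0..}) (\<alpha> a b)"
      using standing unfolding standing_assumptions_def by blast
    then show ?thesis by (rule limits_le_across_integral_edge[OF _ _ lim B edge])
  qed
  have "integral_edge \<alpha> b a" if "integral_edge \<alpha> a b" for a b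
    using that by (simp add: integral_edge_def weight_sym[of a b])
  then have eq: "L a = L b" if "integral_edge \<alpha> a b" for a b
    using le that by (meson order_antisym)
  have "(i, j) \<in> {(a, b). a \<noteq> b \<and> integral_edge \<alpha> a b}\<^sup>*"
    using conn by (auto simp: integrally_connected_def)
  then show ?thesis
    by (induction rule: rtrancl_induct) (use eq in auto)
qed

section \<open>From output limits to consensus\<close>

lemma sat_tendsto:
  assumes "((\<lambda>t. x t i) \<longlongrightarrow> C) at_top"
  shows "((\<lambda>t. y t i) \<longlongrightarrow> sat (s i) C) at_top"
  unfolding sat_eq_clamp[OF s_pos] by (intro tendsto_intros assms)

text \<open>The output is eventually strictly inside the clamping range, where it coincides with the
  state.\<close>

lemma tendsto_if_unsaturated_limit:
  assumes lim: "((\<lambda>t. y t i) \<longlongrightarrow> Y) at_top" and "\<bar>Y\<bar> < s i"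
  shows "((\<lambda>t. x t i) \<longlongrightarrow> Y) at_top"
proof (rule Lim_transform_eventually[OF lim])
  have "\<forall>\<^sub>F t in at_top. - s i < y t i" "\<forall>\<^sub>F t in at_top. y t i < s i"
    using order_tendstoD[OF lim] assms(2) by auto
  then show "\<forall>\<^sub>F t in at_top. y t i = x t i"
    by eventually_elim (auto simp: y_eq max_def min_def split: if_splits)
qed

lemma total_tendsto:
  assumes "\<And>i. ((\<lambda>t. x t i) \<longlongrightarrow> Z i) at_top"
  shows "(\<Sum>i\<in>UNIV. Z i) = (\<Sum>i\<in>UNIV. x t0 i)"
proof (rule tendsto_unique)
  show "((\<lambda>t. \<Sum>i\<in>UNIV. x t i) \<longlongrightarrow> (\<Sum>i\<in>UNIV. Z i)) at_top"
    by (intro tendsto_sum assms)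
  have "\<forall>\<^sub>F t in at_top. (\<Sum>i\<in>UNIV. x t0 i) = (\<Sum>i\<in>UNIV. x t i)"
    using eventually_ge_at_top[of t0] by eventually_elim (rule total_conserved[symmetric])
  then show "((\<lambda>t. \<Sum>i\<in>UNIV. x t i) \<longlongrightarrow> (\<Sum>i\<in>UNIV. x t0 i)) at_top"
    by (rule Lim_transform_eventually[OF tendsto_const])
qed simp

lemma consensus_imp_average_le:
  assumes "standing_assumptions \<alpha>" "integrally_connected \<alpha>"
    and least: "\<And>i. i \<noteq> k \<Longrightarrow> s k < s i" and "k' \<noteq> k"
    and "consensus x"
  shows "\<bar>\<Sum>i\<in>UNIV. x t0 i\<bar> / real CARD('n) \<le> s k"
proof -
  obtain C where C: "\<And>i. ((\<lambda>t. x t i) \<longlongrightarrow> C) at_top"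
    using assms by (auto simp: consensus_def)
  \<comment> \<open>Clamping at two different levels gives the same value only if \<open>C\<close>
    does not exceed the smaller level in modulus. By conservation \<open>C\<close> is the initial
    average.\<close>
  have "sat (s k) C = sat (s k') C"
    using limits_equal[of "\<lambda>i. sat (s i) C"] assms sat_tendsto[OF C] by blast
  then have "\<bar>C\<bar> \<le> s k"
    using least[of k'] \<open>k' \<noteq> k\<close> s_pos[of k] s_pos[of k'] unfolding sat_eq_clamp[OF s_pos]
    by (auto simp: max_def min_def split: if_splits)
  moreover have "(\<Sum>i\<in>UNIV. x t0 i) = real CARD('n) * C"
    using total_tendsto[OF C] by simp
  ultimately show ?thesis by (simp add: abs_mult)
qed

lemma average_le_imp_consensus:
  assumes "standing_assumptions \<alpha>" "integrally_connected \<alpha>"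
    and least: "\<And>i. i \<noteq> k \<Longrightarrow> s k < s i"
    and avg: "\<bar>\<Sum>i\<in>UNIV. x t0 i\<bar> / real CARD('n) \<le> s k"
  shows "consensus x"
proof -
  define S where "S = (\<Sum>i\<in>UNIV. x t0 i)"
  define N where "N = real CARD('n)"
  obtain L where L: "\<And>i. ((\<lambda>t. y t i) \<longlongrightarrow> L i) at_top"
    using y_convergent by metis
  define Y where "Y = L k"
  have Y: "((\<lambda>t. y t i) \<longlongrightarrow> Y) at_top" for i
    using L[of i] limits_equal[OF assms(1,2) L, of i k] by (simp add: Y_def)
  have "\<bar>Y\<bar> \<le> s k"
    by (rule tendsto_upperbound[OF tendsto_rabs[OF Y]]) (auto intro: always_eventually abs_y_le)
  then have others: "((\<lambda>t. x t i) \<longlongrightarrow> Y) at_top" if "i \<noteq> k" for i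
    using tendsto_if_unsaturated_limit[OF Y] least[OF that] by simp
  \<comment> \<open>The limit of \<open>x t k\<close> forced by the conserved total once all other
    states tend to \<open>Y\<close>.\<close>
  define Z where "Z = S - (N - 1) * Y"
  have "((\<lambda>t. S - (\<Sum>i\<in>UNIV - {k}. x t i)) \<longlongrightarrow> S - (\<Sum>i\<in>UNIV - {k}. Y)) at_top"
    by (intro tendsto_intros others) auto
  moreover have "S - (\<Sum>i\<in>UNIV - {k}. Y) = Z"
    by (simp add: Z_def N_def card_Diff_singleton of_nat_diff Suc_leI)
  moreover have "\<forall>\<^sub>F t in at_top. S - (\<Sum>i\<in>UNIV - {k}. x t i) = x t k"
    using eventually_ge_at_top[of t0]
  proof eventually_elim
    case (elim t)
    then show ?case
      using total_conserved[of t] sum.remove[of UNIV k "x t"] by (simp add: S_def)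
  qed
  ultimately have Z: "((\<lambda>t. x t k) \<longlongrightarrow> Z) at_top"
    by (auto intro: Lim_transform_eventually)
  have "sat (s k) Z = Y"
    by (rule tendsto_unique[OF _ sat_tendsto[OF Z] Y]) simp
  moreover have "\<bar>S\<bar> \<le> N * s k"
    using avg by (simp add: S_def N_def pos_divide_le_eq mult.commute)
  \<comment> \<open>If \<open>Z > s k\<close>, then \<open>Y = s k\<close> and
    \<open>S = Z + (N - 1) * Y\<close> would exceed \<open>N * s k\<close>, against the bound on the
    average; the case \<open>Z < - s k\<close> is symmetric. Otherwise clamping leaves
    \<open>Z\<close> unchanged.\<close>
  ultimately have "Z = Y"
    using s_pos[of k] unfolding sat_eq_clamp[OF s_pos] Z_def
    by (auto simp: max_def min_def algebra_simps abs_le_iff split: if_splits)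
  with Z others have "((\<lambda>t. x t i) \<longlongrightarrow> Y) at_top" for i by (cases "i = k") auto
  then show ?thesis by (auto simp: consensus_def)
qed

end

theorem theorem3:
  fixes \<alpha> :: "'n::finite \<Rightarrow> 'n \<Rightarrow> real \<Rightarrow> real"
    and s :: "'n \<Rightarrow> real"
    and x :: "real \<Rightarrow> 'n \<Rightarrow> real"
    and t0 \<alpha>min \<alpha>max :: real
  assumes s_pos: "\<forall>i. s i > 0"
    and s_distinct: "inj s"
    and standing: "standing_assumptions \<alpha>"
    and connected: "integrally_connected \<alpha>"
    and bounds: "0 < \<alpha>min" "\<alpha>min \<le> \<alpha>max"
    and weights: "\<forall>i j t. t \<ge> 0 \<longrightarrow> \<alpha> i j t = 0 \<or> (\<alpha>min \<le> \<alpha> i j t \<and> \<alpha> i j t \<le> \<alpha>max)"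
    and t0: "t0 \<ge> 0"
    and sol: "caratheodory_solution \<alpha> s t0 x"
    and not_all_equal: "\<exists>i j. x t0 i \<noteq> x t0 j"
  shows "consensus x \<longleftrightarrow>
           \<bar>\<Sum>i\<in>UNIV. x t0 i\<bar> / real CARD('n) \<le> (MIN i. s i)"
proof -
  interpret saturated_network \<alpha> s x t0 \<alpha>max
  proof
    show "\<alpha> i j t \<le> \<alpha>max" if "0 \<le> t" for i j t
      using weights bounds that by (metis less_imp_le order_trans)
    show "\<alpha> i j t = \<alpha> j i t" for i j t
      using standing unfolding standing_assumptions_def by blast
    show "0 \<le> \<alpha> i j t" if "0 \<le> t" for i j t
      using standing that unfolding standing_assumptions_def by blast
  qed (use s_pos t0 sol in auto)
  have "(MIN i. s i) \<in> range s" by (rule Min_in) auto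
  then obtain k where k: "(MIN i. s i) = s k" by (rule imageE)
  have least: "s k < s i" if "i \<noteq> k" for i
  proof -
    have "s k \<le> s i" unfolding k[symmetric] by (rule Min_le) auto
    moreover have "s k \<noteq> s i" using s_distinct that by (auto dest: injD)
    ultimately show ?thesis by simp
  qed
  \<comment> \<open>Unequal initial states provide a second agent, whose level is strictly larger
    than \<open>s k\<close>.\<close>
  obtain k' where "k' \<noteq> k" using not_all_equal by metis
  then show ?thesis
    unfolding k
    using consensus_imp_average_le[OF standing connected least]
      average_le_imp_consensus[OF standing connected least] by blast
qed

end
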